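(* For every positive integer $n$, the numerical semigroup $\langle n, n+1, n+2\rangle$ (with generating set $S=\{n,n+1,n+2\}$) is greedy in the general sense, i.e. $\mathrm{GreedyCost}_S(k)=\mathrm{MinCost}_S(k)$ for every $k\in\langle S\rangle$ with $k>0$.
   Context: For a finite set $S=\{s_1<s_2<\dots<s_t\}$ of positive integers with $\gcd(s_1,\dots,s_t)=1$, $\langle S\rangle=\{\sum_i a_i s_i : a_i\in\mathbb{N}_0\}$ is the numerical semigroup generated by $S$. A representation of $k\in\langle S\rangle$ is a vector $(a_1,\dots,a_t)\in\mathbb{N}_0^t$ with $\sum_i a_i s_i=k$; its cost is $\sum_i a_i$. $\mathrm{MinCost}_S(k)$ is the minimum cost over all representations of $k$. The (generalized) greedy representation of $k\in\langle S\rangle$, $k>0$, is computed as follows: set $r:=k$; for $i=t,t-1,\dots,1$ let $a_i$ be the largest integer $q\ge 0$ such that $r-q s_i\in\langle S\rangle$, and replace $r$ by $r-a_i s_i$ (at the end $r=0$). $\mathrm{GreedyCost}_S(k)=\sum_i a_i$ for this vector. $S$ (equivalently $\langle S\rangle$) is called greedy (in the general sense) if $\mathrm{GreedyCost}_S(k)=\mathrm{MinCost}_S(k)$ for all $k\in\langle S\rangle$, $k>0$. *)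

theory Defs
  imports Main
begin

text \<open>
  A vector indexed by the elements of a generating set \<open>S\<close> is a function on \<open>S\<close>; its values
  outside \<open>S\<close> are irrelevant. The notions below are meant for generating sets satisfying
  \<open>numerical_gens\<close>.
\<close>

definition numerical_gens :: "nat set \<Rightarrow> bool" where
  "numerical_gens S \<longleftrightarrow> finite S \<and> (\<forall>s\<in>S. s > 0) \<and> Gcd S = 1"

definition represents :: "nat set \<Rightarrow> (nat \<Rightarrow> nat) \<Rightarrow> nat \<Rightarrow> bool" where
  "represents S a k \<longleftrightarrow> (\<Sum>s\<in>S. a s * s) = k"

definition semigroup_gen :: "nat set \<Rightarrow> nat set" where
  "semigroup_gen S = {k. \<exists>a. represents S a k}"

definition cost :: "nat set \<Rightarrow> (nat \<Rightarrow> nat) \<Rightarrow> nat" where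
  "cost S a = (\<Sum>s\<in>S. a s)"

definition min_cost :: "nat set \<Rightarrow> nat \<Rightarrow> nat" where
  "min_cost S k = (LEAST c. \<exists>a. represents S a k \<and> cost S a = c)"

text \<open>
  The list argument holds the generators still to be processed. The guard \<open>q * s \<le> r\<close> excludes
  truncated subtraction; for \<open>s > 0\<close> and \<open>r \<in> semigroup_gen S\<close> it bounds \<open>q\<close>, and \<open>q = 0\<close> is
  admissible, so the maximum exists.
\<close>

fun greedy_coeffs :: "nat set \<Rightarrow> nat list \<Rightarrow> nat \<Rightarrow> nat \<Rightarrow> nat" where
  "greedy_coeffs S [] r = (\<lambda>_. 0)"
| "greedy_coeffs S (s # ss) r =
     (let q = (GREATEST q. q * s \<le> r \<and> r - q * s \<in> semigroup_gen S)
      in (greedy_coeffs S ss (r - q * s))(s := q))"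

definition greedy_rep :: "nat set \<Rightarrow> nat \<Rightarrow> nat \<Rightarrow> nat" where
  "greedy_rep S k = greedy_coeffs S (rev (sorted_list_of_set S)) k"

definition greedy_cost :: "nat set \<Rightarrow> nat \<Rightarrow> nat" where
  "greedy_cost S k = cost S (greedy_rep S k)"

definition greedy :: "nat set \<Rightarrow> bool" where
  "greedy S \<longleftrightarrow> (\<forall>k\<in>semigroup_gen S. k > 0 \<longrightarrow> greedy_cost S k = min_cost S k)"

lemma numerical_gens_three_consecutive:
  fixes n :: nat
  assumes "n > 0"
  shows "numerical_gens {n, n + 1, n + 2}"
proof -
  have "Gcd {n, n + 1, n + 2} dvd (n + 1) - n"
    by (intro dvd_diff_nat Gcd_dvd) auto
  then show ?thesis
    using assms by (simp add: numerical_gens_def del: Gcd_insert)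
qed

end

theory Submission imports Defs begin

text \<open>
  A sum of \<open>m\<close> generators can take every value between \<open>m * n\<close> and \<open>m * (n + 2)\<close>, and only these.
  So if \<open>k\<close> is a sum of \<open>m\<close> generators and \<open>r = k - q * (n + 2)\<close> lies in the semigroup, then \<open>r\<close>
  is a sum of at most \<open>m - q\<close> generators: taking out copies of the largest generator loses nothing.
  For the maximal \<open>q\<close> no representation of \<open>r\<close> uses \<open>n + 2\<close>, and among the representations of
  \<open>r\<close> by \<open>n\<close> and \<open>n + 1\<close> the greedy one has the most copies of \<open>n + 1\<close>, hence the smallest cost.
\<close>

lemma represents_three_consecutive:
  "represents {n, n + 1, n + 2} a k \<longleftrightarrow> a n * n + a (n + 1) * (n + 1) + a (n + 2) * (n + 2) = k"
  by (simp add: represents_def add.assoc)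

lemma cost_three_consecutive: "cost {n, n + 1, n + 2} a = a n + a (n + 1) + a (n + 2)"
  by (simp add: cost_def)

lemma semigroup_gen_three_consecutive_iff:
  "k \<in> semigroup_gen {n, n + 1, n + 2} \<longleftrightarrow>
    (\<exists>x y z. x * n + y * (n + 1) + z * (n + 2) = k)"
proof
  assume "\<exists>x y z. x * n + y * (n + 1) + z * (n + 2) = k"
  then obtain x y z where xyz: "x * n + y * (n + 1) + z * (n + 2) = k" by blast
  have "represents {n, n + 1, n + 2} (\<lambda>s. if s = n then x else if s = n + 1 then y else z) k"
    unfolding represents_three_consecutive using xyz by simp
  then show "k \<in> semigroup_gen {n, n + 1, n + 2}"
    unfolding semigroup_gen_def by blast
qed (auto simp only: semigroup_gen_def represents_three_consecutive mem_Collect_eq)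

text \<open>Start from \<open>m\<close> copies of \<open>n\<close> and distribute the excess
  \<open>j = k - m * n\<close>: raise \<open>j div 2\<close> copies by 2 and, if \<open>j\<close> is
  odd, one more by 1. As \<open>j \<le> 2 * m\<close>, there are enough copies.\<close>

lemma three_consecutive_sum_between:
  fixes k m n :: nat
  assumes "m * n \<le> k" "k \<le> m * (n + 2)"
  obtains x y z where "x * n + y * (n + 1) + z * (n + 2) = k" "x + y + z = m"
proof -
  define j where "j = k - m * n"
  define y where "y = j mod 2"
  define z where "z = j div 2"
  have j: "j = y + 2 * z" "k = m * n + j" "j \<le> 2 * m" "y \<le> 1"
    using assms by (auto simp: j_def y_def z_def algebra_simps)
  then have "y + z \<le> m" by linarith
  then obtain x where x: "m = y + z + x" by (metis le_Suc_ex)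
  have "x * n + y * (n + 1) + z * (n + 2) = k"
    unfolding j(2) j(1) x by (simp add: algebra_simps)
  then show thesis by (rule that) (use x in simp)
qed

lemma greedy_step:
  fixes s r :: nat and S :: "nat set"
  defines "q \<equiv> GREATEST q. q * s \<le> r \<and> r - q * s \<in> semigroup_gen S"
  assumes "s > 0" "r \<in> semigroup_gen S"
  shows "q * s \<le> r" "r - q * s \<in> semigroup_gen S"
    and "\<And>p. p * s \<le> r \<Longrightarrow> r - p * s \<in> semigroup_gen S \<Longrightarrow> p \<le> q"
proof -
  let ?P = "\<lambda>q. q * s \<le> r \<and> r - q * s \<in> semigroup_gen S"
  \<comment> \<open>\<open>GREATEST\<close> is only meaningful with an upper bound:
    \<open>s \<ge> 1\<close> gives \<open>p \<le> p * s \<le> r\<close>.\<close>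
  have bound: "\<And>p. ?P p \<Longrightarrow> p \<le> r"
    using assms(2) by (metis le_trans mult.right_neutral mult_le_mono2 Suc_leI One_nat_def)
  have "?P q"
    unfolding q_def by (rule GreatestI_nat[of ?P 0 r]) (use assms(3) bound in auto)
  then show "q * s \<le> r" "r - q * s \<in> semigroup_gen S" by auto
  show "p \<le> q" if "p * s \<le> r" "r - p * s \<in> semigroup_gen S" for p
    unfolding q_def by (rule Greatest_le_nat[of ?P p r]) (use that bound in auto)
qed

text \<open>Replaces the \<open>GREATEST\<close> operators by maximality among representations of
  \<open>k\<close>: first of \<open>z\<close>, then of \<open>y\<close> for this \<open>z\<close>.
  The optimality argument uses nothing else about the greedy coefficients.\<close>

lemma greedy_rep_three_consecutive:
  fixes n k :: nat
  assumes "n > 0" "k \<in> semigroup_gen {n, n + 1, n + 2}"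
  obtains x y z where
    "greedy_rep {n, n + 1, n + 2} k = (\<lambda>_. 0)(n := x, n + 1 := y, n + 2 := z)"
    "x * n + y * (n + 1) + z * (n + 2) = k"
    "\<And>x' y' z'. x' * n + y' * (n + 1) + z' * (n + 2) = k \<Longrightarrow> z' \<le> z"
    "\<And>x' y'. x' * n + y' * (n + 1) + z * (n + 2) = k \<Longrightarrow> y' \<le> y"
proof -
  let ?S = "{n, n + 1, n + 2}"
  define z where "z = (GREATEST q. q * (n + 2) \<le> k \<and> k - q * (n + 2) \<in> semigroup_gen ?S)"
  define r where "r = k - z * (n + 2)"
  define y where "y = (GREATEST q. q * (n + 1) \<le> r \<and> r - q * (n + 1) \<in> semigroup_gen ?S)"
  define t where "t = r - y * (n + 1)"
  define x where "x = (GREATEST q. q * n \<le> t \<and> t - q * n \<in> semigroup_gen ?S)"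
  note z = greedy_step[of "n + 2", OF _ assms(2), folded z_def, folded r_def]
  note y = greedy_step[of "n + 1", OF _ z(2), folded y_def, folded t_def]
  note x = greedy_step[OF assms(1) y(2), folded x_def]
  have z_max: "z' \<le> z" if "x' * n + y' * (n + 1) + z' * (n + 2) = k" for x' y' z'
  proof (rule z(3))
    have "k - z' * (n + 2) = x' * n + y' * (n + 1) + 0 * (n + 2)"
      using that by linarith
    then show "k - z' * (n + 2) \<in> semigroup_gen ?S"
      unfolding semigroup_gen_three_consecutive_iff by metis
  qed (use that in linarith)+
  have y_max: "y' \<le> y" if "x' * n + y' * (n + 1) + z' * (n + 2) = r" for x' y' z'
  proof (rule y(3))
    have "r - y' * (n + 1) = x' * n + 0 * (n + 1) + z' * (n + 2)"
      using that by linarith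
    then show "r - y' * (n + 1) \<in> semigroup_gen ?S"
      unfolding semigroup_gen_three_consecutive_iff by metis
  qed (use that in linarith)+
  have k: "k = r + z * (n + 2)" and r: "r = t + y * (n + 1)"
    using z(1) y(1) by (simp_all add: r_def t_def)
  have t: "t = x * n"
  proof -
    \<comment> \<open>Putting the removed \<open>y\<close> and \<open>z\<close> copies back turns a
      representation of \<open>t\<close> into one of \<open>k\<close>, so \<open>c > 0\<close> would
      contradict the choice of \<open>z\<close>; likewise \<open>b > 0\<close> that of
      \<open>y\<close>. Only copies of \<open>n\<close> remain.\<close>
    obtain a b c where abc: "a * n + b * (n + 1) + c * (n + 2) = t"
      using y(2) unfolding semigroup_gen_three_consecutive_iff by auto
    have "a * n + (b + y) * (n + 1) + (c + z) * (n + 2) = k"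
      using abc k r by (simp only: add_mult_distrib)
    then have "c = 0" using z_max by fastforce
    have "a * n + (b + y) * (n + 1) + c * (n + 2) = r"
      using abc r by (simp only: add_mult_distrib)
    then have "b = 0" using y_max by fastforce
    have "t = a * n" using abc \<open>b = 0\<close> \<open>c = 0\<close> by simp
    have "0 * n + 0 * (n + 1) + 0 * (n + 2) = t - a * n"
      using \<open>t = a * n\<close> by simp
    then have "t - a * n \<in> semigroup_gen ?S"
      unfolding semigroup_gen_three_consecutive_iff by blast
    then have "a \<le> x" using x(3) \<open>t = a * n\<close> by simp
    moreover have "x \<le> a" using x(1) \<open>t = a * n\<close> assms(1) by simp
    ultimately show ?thesis using \<open>t = a * n\<close> by simp
  qed
  have sorted: "rev (sorted_list_of_set ?S) = [n + 2, n + 1, n]"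
    using sorted_list_of_set.idem_if_sorted_distinct[of "[n, n + 1, n + 2]"] by simp
  show thesis
  proof (rule that)
    show "greedy_rep ?S k = (\<lambda>_. 0)(n := x, n + 1 := y, n + 2 := z)"
      unfolding greedy_rep_def sorted greedy_coeffs.simps Let_def
        z_def[symmetric] r_def[symmetric] y_def[symmetric] t_def[symmetric] x_def[symmetric] ..
    show "x * n + y * (n + 1) + z * (n + 2) = k"
      using k r t by simp
    show "y' \<le> y" if "x' * n + y' * (n + 1) + z * (n + 2) = k" for x' y'
      by (rule y_max[of x' _ 0]) (use that k in simp)
  qed (rule z_max)
qed

theorem theorem3:
  fixes n :: nat
  assumes "n > 0"
  shows "greedy {n, n + 1, n + 2}"
  unfolding greedy_def
proof (intro ballI impI)
  fix k
  assume "k \<in> semigroup_gen {n, n + 1, n + 2}"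
  then obtain x y z
    where rep: "greedy_rep {n, n + 1, n + 2} k = (\<lambda>_. 0)(n := x, n + 1 := y, n + 2 := z)"
    and k: "x * n + y * (n + 1) + z * (n + 2) = k"
    and z_max: "\<And>x' y' z'. x' * n + y' * (n + 1) + z' * (n + 2) = k \<Longrightarrow> z' \<le> z"
    and y_max: "\<And>x' y'. x' * n + y' * (n + 1) + z * (n + 2) = k \<Longrightarrow> y' \<le> y"
    using greedy_rep_three_consecutive[OF assms] by metis
  let ?S = "{n, n + 1, n + 2}"
  have cost: "greedy_cost ?S k = x + y + z"
    unfolding greedy_cost_def rep cost_three_consecutive by simp
  \<comment> \<open>The cost of every representation of \<open>k\<close> satisfies these two bounds,
    so they are all that is needed of a competitor.\<close>
  have "x + y + z \<le> m" if m: "m * n \<le> k" "k \<le> m * (n + 2)" for m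
  proof (rule ccontr)
    assume *: "\<not> x + y + z \<le> m"
    have "z * (n + 2) \<le> m * (n + 2)" using k m(2) by linarith
    then have "z \<le> m" by (simp only: mult_le_cancel2)
    then obtain d where d: "m = z + d" using le_Suc_ex by blast
    define r where "r = x * n + y * (n + 1)"
    \<comment> \<open>The assumption for contradiction says \<open>d < x + y\<close>; it provides
      the lower bound for writing \<open>r\<close> as a sum of \<open>d\<close> generators.\<close>
    have "d * n \<le> (x + y) * n" using * d by (intro mult_le_mono1) simp
    then have "d * n \<le> r" by (simp add: r_def algebra_simps)
    moreover have "r \<le> d * (n + 2)"
      using m(2) k unfolding d r_def add_mult_distrib by linarith
    ultimately obtain a b c where abc: "a * n + b * (n + 1) + c * (n + 2) = r" "a + b + c = d"
      by (rule three_consecutive_sum_between)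
    have "a * n + b * (n + 1) + (c + z) * (n + 2) = k"
      using abc(1) k unfolding r_def add_mult_distrib by linarith
    then have "c = 0" using z_max by fastforce
    with abc(1) k have "a * n + b * (n + 1) + z * (n + 2) = k"
      by (simp add: r_def)
    then have "b \<le> y" by (rule y_max)
    \<comment> \<open>Both sides are \<open>r\<close>, sorted by number of summands. Since
      \<open>b \<le> y\<close>, the greedy side has no more summands, against
      \<open>a + b = d < x + y\<close>.\<close>
    have "(x + y) * n + y = (a + b) * n + b"
      using abc(1) \<open>c = 0\<close> unfolding r_def by (simp add: algebra_simps)
    then have "(x + y) * n \<le> (a + b) * n" using \<open>b \<le> y\<close> by linarith
    then have "x + y \<le> a + b" using assms by simp
    then show False using * d abc(2) \<open>c = 0\<close> by linarith
  qed
  then have minimal: "x + y + z \<le> cost ?S a" if "represents ?S a k" for a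
    using that unfolding represents_three_consecutive cost_three_consecutive
    by (auto simp: algebra_simps)
  have "represents ?S (greedy_rep ?S k) k"
    unfolding represents_three_consecutive rep using k by simp
  then have "min_cost ?S k = x + y + z"
    unfolding min_cost_def using cost minimal
    by (intro Least_equality) (auto simp: greedy_cost_def simp del: insert_iff)
  then show "greedy_cost ?S k = min_cost ?S k" using cost by simp
qed

end
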